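(* Let $k$ be a field, let $R,S$ be standard graded polynomial rings over $k$ of positive Krull dimension with graded maximal ideals $\mathfrak m,\mathfrak n$, and let $T=R\otimes_k S$. Let $I\subseteq \mathfrak m^2\subseteq R$ and $J\subseteq \mathfrak n^2\subseteq S$ be homogeneous ideals, and let $F=I+J+\mathfrak m\mathfrak n\subseteq T$. Assume that either $\operatorname{char} k=0$ or $I$ and $J$ are monomial ideals. Assume moreover that $I$ or $J$ is non-zero. Then for all $s\ge 2$, $\operatorname{depth}(T/F^s)=0$.
   Context: Ideals of $R$ and $S$ are identified with their extensions to $T$; thus $F$ is the ideal of $T$ generated by $I$, $J$ and $\mathfrak m\mathfrak n$ (the "fiber product" of $I$ and $J$). Depth of a finitely generated graded $T$-module is taken with respect to the graded maximal ideal of $T$. *)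

theory Defs
  imports
    "HOL-Library.Poly_Mapping"
    "HOL-Library.Extended_Nat"
    "HOL-Algebra.Algebra"
begin

section \<open>Polynomial rings\<close>

text \<open>
  The polynomial ring over a field \<open>'k\<close> in variables indexed by a type \<open>'v\<close>: an exponent vector is
  a finitely supported map \<open>'v \<Rightarrow>\<^sub>0 nat\<close> and a polynomial is a finitely supported map from exponent
  vectors to coefficients, multiplied by convolution.  For finite \<open>'v\<close> the Krull dimension is
  \<open>CARD('v)\<close>, which is positive because types are inhabited.
\<close>

type_synonym ('v, 'k) mpoly = "('v \<Rightarrow>\<^sub>0 nat) \<Rightarrow>\<^sub>0 'k"

definition mpoly_ring :: "('v, 'k::field) mpoly ring" where
  "mpoly_ring = \<lparr>carrier = UNIV, monoid.mult = (*), monoid.one = 1, ring.zero = 0, ring.add = (+)\<rparr>"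

lemma mpoly_ring_simps [simp]:
  "carrier mpoly_ring = UNIV"
  "p \<otimes>\<^bsub>mpoly_ring\<^esub> q = p * q"
  "\<one>\<^bsub>mpoly_ring\<^esub> = 1"
  "\<zero>\<^bsub>mpoly_ring\<^esub> = 0"
  "p \<oplus>\<^bsub>mpoly_ring\<^esub> q = p + q"
  by (simp_all add: mpoly_ring_def)

lemma cring_mpoly_ring: "cring mpoly_ring"
proof (rule cringI)
  show "abelian_group (mpoly_ring :: ('v, 'k::field) mpoly ring)"
    by (rule abelian_groupI) (auto simp: add_ac intro: exI [of _ "- _"] left_minus)
  show "comm_monoid (mpoly_ring :: ('v, 'k::field) mpoly ring)"
    by (rule comm_monoidI) (auto simp: mult_ac)
qed (auto simp: distrib_right)

definition mpoly_var :: "'v \<Rightarrow> ('v, 'k::field) mpoly" where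
  "mpoly_var v = Poly_Mapping.single (Poly_Mapping.single v 1) 1"

definition mpoly_monom :: "('v \<Rightarrow>\<^sub>0 nat) \<Rightarrow> ('v, 'k::field) mpoly" where
  "mpoly_monom t = Poly_Mapping.single t 1"

definition graded_max :: "('v, 'k::field) mpoly set" where
  "graded_max = Idl\<^bsub>mpoly_ring\<^esub> (range mpoly_var)"

definition monom_degree :: "('v \<Rightarrow>\<^sub>0 nat) \<Rightarrow> nat" where
  "monom_degree t = (\<Sum>v\<in>Poly_Mapping.keys t. Poly_Mapping.lookup t v)"

definition homogeneous :: "nat \<Rightarrow> ('v, 'k::field) mpoly \<Rightarrow> bool" where
  "homogeneous d p \<longleftrightarrow> (\<forall>t\<in>Poly_Mapping.keys p. monom_degree t = d)"

definition homogeneous_ideal :: "('v, 'k::field) mpoly set \<Rightarrow> bool" where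
  "homogeneous_ideal I \<longleftrightarrow>
     (\<exists>G. (\<forall>g\<in>G. \<exists>d. homogeneous d g) \<and> I = Idl\<^bsub>mpoly_ring\<^esub> G)"

definition monomial_ideal :: "('v, 'k::field) mpoly set \<Rightarrow> bool" where
  "monomial_ideal I \<longleftrightarrow> (\<exists>E. I = Idl\<^bsub>mpoly_ring\<^esub> (mpoly_monom ` E))"

text \<open>Powers in the multiplicative monoid of ideals; the zeroth power is the whole ring.\<close>

abbreviation ideal_pow :: "('v, 'k::field) mpoly set \<Rightarrow> nat \<Rightarrow> ('v, 'k) mpoly set" where
  "ideal_pow I n \<equiv> I [^]\<^bsub>ideals_set mpoly_ring\<^esub> n"


section \<open>The tensor product and the fiber product\<close>

text \<open>
  \<open>push_forward f\<close> is the additive map sending the basis element at \<open>t\<close> to the one at \<open>f t\<close>.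
  Applied twice it renames variables: on exponent vectors along \<open>f\<close>, then on polynomials along the
  resulting map of exponent vectors.
\<close>

definition push_forward :: "('s \<Rightarrow> 't) \<Rightarrow> ('s \<Rightarrow>\<^sub>0 'c::comm_monoid_add) \<Rightarrow> ('t \<Rightarrow>\<^sub>0 'c)" where
  "push_forward f p =
     (\<Sum>t\<in>Poly_Mapping.keys p. Poly_Mapping.single (f t) (Poly_Mapping.lookup p t))"

definition mpoly_rename :: "('v \<Rightarrow> 'w) \<Rightarrow> ('v, 'k::field) mpoly \<Rightarrow> ('w, 'k) mpoly" where
  "mpoly_rename f = push_forward (push_forward f)"

text \<open>
  With \<open>R = ('a, 'k) mpoly\<close> and \<open>S = ('b, 'k) mpoly\<close>, the tensor product of \<open>R\<close> and \<open>S\<close> over \<open>'k\<close>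
  is the polynomial ring \<open>T = ('a + 'b, 'k) mpoly\<close> in the disjoint union of the variables, where
  \<open>mpoly_rename Inl\<close> and \<open>mpoly_rename Inr\<close> are the maps taking \<open>p\<close> to \<open>p \<otimes> 1\<close> and \<open>q\<close> to \<open>1 \<otimes> q\<close>.
\<close>

definition extend_left :: "('a, 'k::field) mpoly set \<Rightarrow> ('a + 'b, 'k) mpoly set" where
  "extend_left I = Idl\<^bsub>mpoly_ring\<^esub> (mpoly_rename Inl ` I)"

definition extend_right :: "('b, 'k::field) mpoly set \<Rightarrow> ('a + 'b, 'k) mpoly set" where
  "extend_right J = Idl\<^bsub>mpoly_ring\<^esub> (mpoly_rename Inr ` J)"

definition fiber_product ::
    "('a, 'k::field) mpoly set \<Rightarrow> ('b, 'k) mpoly set \<Rightarrow> ('a + 'b, 'k) mpoly set" where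
  "fiber_product I J =
     extend_left I <+>\<^bsub>mpoly_ring\<^esub> extend_right J
       <+>\<^bsub>mpoly_ring\<^esub> (extend_left graded_max \<cdot>\<^bsub>mpoly_ring\<^esub> extend_right graded_max)"


section \<open>Quotient modules and depth\<close>

text \<open>The quotient ring \<open>R / Q\<close> as an \<open>R\<close>-module, by restriction of scalars along \<open>R \<rightarrow> R / Q\<close>.\<close>

definition quot_module :: "('a, 'm) ring_scheme \<Rightarrow> 'a set \<Rightarrow> ('a, 'a set) module" where
  "quot_module R Q =
     ring.extend (R Quot Q) \<lparr>smult = (\<lambda>a C. (Q +>\<^bsub>R\<^esub> a) \<otimes>\<^bsub>R Quot Q\<^esub> C)\<rparr>"

lemma (in cring) module_quot_module:
  assumes "ideal Q R"
  shows "module R (quot_module R Q)"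
proof -
  interpret Q: ideal Q R by fact
  interpret h: ring_hom_ring R "R Quot Q" "(+>) Q" by (rule Q.rcos_ring_hom_ring)
  note [simp] = quot_module_def ring.defs
  show ?thesis
  proof (rule moduleI)
    show "cring R" by (rule is_cring)
    have "\<exists>y\<in>carrier (R Quot Q). y \<oplus>\<^bsub>R Quot Q\<^esub> x = \<zero>\<^bsub>R Quot Q\<^esub>"
      if "x \<in> carrier (R Quot Q)" for x
      using that h.S.l_neg h.S.a_inv_closed by blast
    then show "abelian_group (quot_module R Q)"
      by (intro abelian_groupI) (simp_all add: h.S.a_ac)
  qed (simp_all add: h.S.l_distr h.S.r_distr h.S.m_assoc)
qed

text \<open>The submodule of \<open>M\<close> generated by all \<open>a x\<close> with \<open>a\<close> in \<open>A\<close> and \<open>x\<close> in \<open>M\<close>.\<close>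

definition smult_set :: "('a, 'm) ring_scheme \<Rightarrow> ('a, 'b, 'n) module_scheme \<Rightarrow> 'a set \<Rightarrow> 'b set" where
  "smult_set R M A =
     \<Inter>{N. submodule N R M \<and> (\<forall>a\<in>A. \<forall>x\<in>carrier M. a \<odot>\<^bsub>M\<^esub> x \<in> N)}"

text \<open>
  \<open>x\<^sub>1, \<dots>, x\<^sub>n\<close> is regular on \<open>M\<close> if each \<open>x\<^sub>i\<close> is a nonzerodivisor on
  \<open>M / (x\<^sub>1, \<dots>, x\<^sub>i\<^sub>-\<^sub>1) M\<close> and \<open>M \<noteq> (x\<^sub>1, \<dots>, x\<^sub>n) M\<close>; the first condition is
  spelled out on representatives.
\<close>

definition regular_seq :: "('a, 'm) ring_scheme \<Rightarrow> ('a, 'b, 'n) module_scheme \<Rightarrow> 'a list \<Rightarrow> bool" where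
  "regular_seq R M xs \<longleftrightarrow>
     set xs \<subseteq> carrier R \<and>
     (\<forall>i<length xs. \<forall>x\<in>carrier M.
        xs ! i \<odot>\<^bsub>M\<^esub> x \<in> smult_set R M (set (take i xs)) \<longrightarrow> x \<in> smult_set R M (set (take i xs))) \<and>
     smult_set R M (set xs) \<noteq> carrier M"

text \<open>
  Depth of \<open>M\<close> with respect to the ideal \<open>A\<close>, with the usual convention that it is infinite if
  \<open>A M = M\<close> (for \<open>A\<close> the graded maximal ideal and \<open>M\<close> finitely generated graded: if \<open>M = 0\<close>).
\<close>

definition depth :: "('a, 'm) ring_scheme \<Rightarrow> 'a set \<Rightarrow> ('a, 'b, 'n) module_scheme \<Rightarrow> enat" where
  "depth R A M =
     (if smult_set R M A = carrier M then \<infinity>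
      else Sup {enat (length xs) | xs. set xs \<subseteq> A \<and> regular_seq R M xs})"

end

theory Submission
  imports Defs
begin

text \<open>
  Depth zero is witnessed by a socle element of \<open>T / F\<^sup>s\<close>: a polynomial \<open>f \<notin> F\<^sup>s\<close> that every
  variable multiplies into \<open>F\<^sup>s\<close> (\<open>depth_quot_eq_0\<close>).  By symmetry let \<open>I \<noteq> 0\<close>.  Let \<open>d\<close> be the
  least degree of a monomial that occurs in an element of \<open>I\<close>, attained in \<open>g \<in> I\<close>, choose a variable
  \<open>x\<close> of \<open>R\<close> and a variable \<open>y\<close> of \<open>S\<close>, and put
  \<open>f = g x\<^bsup>s-2\<^esup> y\<^bsup>s-1\<^esup>\<close>.

  Variables multiply \<open>f\<close> into \<open>F\<^sup>s\<close> (\<open>graded_max_mult_socle\<close>).  For a variable \<open>u\<close> of \<open>R\<close>,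
  \<open>u f = g \<cdot> (u y) \<cdot> (x y)\<^bsup>s-2\<^esup>\<close> lies in \<open>I (\<mm>\<nn>)\<^bsup>s-1\<^esup>\<close>.  For a variable \<open>v\<close> of
  \<open>S\<close>, \<open>v f = (g y v) \<cdot> (x y)\<^bsup>s-2\<^esup>\<close>, and \<open>g y v \<in> \<mm>\<^sup>2 \<nn>\<^sup>2\<close> because \<open>I \<subseteq> \<mm>\<^sup>2\<close>.

  That \<open>f \<notin> F\<^sup>s\<close> is a matter of degrees.  Give the variables of \<open>R\<close> weight \<open>1\<close> and those of \<open>S\<close> weight
  \<open>d - 1\<close>.  The monomials of \<open>I\<close> have weight at least \<open>d\<close>, those of \<open>J \<subseteq> \<nn>\<^sup>2\<close> at least
  \<open>2 (d - 1) \<ge> d\<close>, since \<open>d \<ge> 2\<close>, and those of \<open>\<mm>\<nn>\<close> at least \<open>1 + (d - 1) = d\<close>.  So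
  every monomial of \<open>F\<^sup>s\<close> has weight at least \<open>s d\<close>, but \<open>f\<close> has a monomial of weight
  \<open>d + (s - 2) + (s - 1) (d - 1) = s d - 1\<close>.
\<close>

section \<open>Depth zero from an annihilated element\<close>

lemma (in module) zero_in_smult_set: "\<zero>\<^bsub>M\<^esub> \<in> smult_set R M A"
  unfolding smult_set_def
proof (intro InterI, clarify)
  fix N assume "submodule N R M"
  then interpret N: submodule N R M .
  show "\<zero>\<^bsub>M\<^esub> \<in> N" using N.one_closed by simp
qed

lemma (in module) smult_set_empty: "smult_set R M {} = {\<zero>\<^bsub>M\<^esub>}"
proof
  have zero: "a \<odot>\<^bsub>M\<^esub> \<zero>\<^bsub>M\<^esub> = \<zero>\<^bsub>M\<^esub>" if "a \<in> carrier R" for a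
  proof -
    have "a \<odot>\<^bsub>M\<^esub> \<zero>\<^bsub>M\<^esub> \<oplus>\<^bsub>M\<^esub> a \<odot>\<^bsub>M\<^esub> \<zero>\<^bsub>M\<^esub> = a \<odot>\<^bsub>M\<^esub> \<zero>\<^bsub>M\<^esub>"
      using that smult_r_distr [of a "\<zero>\<^bsub>M\<^esub>" "\<zero>\<^bsub>M\<^esub>"] by simp
    then show ?thesis
      using that by (simp add: M.add.l_cancel_one)
  qed
  have "submodule {\<zero>\<^bsub>M\<^esub>} R M"
    by (rule submoduleI) (auto simp: zero)
  then show "smult_set R M {} \<subseteq> {\<zero>\<^bsub>M\<^esub>}"
    unfolding smult_set_def by blast
qed (simp add: zero_in_smult_set)

lemma (in module) regular_seq_of_annihilator_is_empty:
  assumes "regular_seq R M xs" and "set xs \<subseteq> A"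
    and "u \<in> carrier M" and "u \<noteq> \<zero>\<^bsub>M\<^esub>" and "\<And>a. a \<in> A \<Longrightarrow> a \<odot>\<^bsub>M\<^esub> u = \<zero>\<^bsub>M\<^esub>"
  shows "xs = []"
proof (rule ccontr)
  assume "xs \<noteq> []"
  then have "0 < length xs" and "xs ! 0 \<in> A"
    using assms(2) by auto
  then have "u \<in> smult_set R M (set (take 0 xs))"
    using assms(1,3,5) zero_in_smult_set unfolding regular_seq_def by metis
  then show False
    using assms(4) by (simp add: smult_set_empty)
qed

text \<open>
  The class of \<open>f\<close> is a nonzero element of \<open>R / Q\<close> killed by \<open>A\<close>, so no element of \<open>A\<close> can start a
  regular sequence.  It also excludes the value \<open>\<infinity>\<close>, which occurs if \<open>A M = M\<close> for \<open>M = R / Q\<close>: the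
  submodule of all \<open>x + Q\<close> with \<open>x f \<in> Q\<close> contains \<open>A M\<close>, but it does not contain \<open>1 + Q\<close>.
\<close>

lemma (in cring) depth_quot_eq_0:
  assumes "ideal Q R" and "A \<subseteq> carrier R" and f: "f \<in> carrier R" "f \<notin> Q"
    and Af: "\<And>a. a \<in> A \<Longrightarrow> a \<otimes> f \<in> Q"
  shows "depth R A (quot_module R Q) = 0"
proof -
  interpret Q: ideal Q R by fact
  let ?M = "quot_module R Q"
  interpret M: module R ?M by (rule module_quot_module) fact
  have carrier: "carrier ?M = (+>) Q ` carrier R"
    by (auto simp: quot_module_def ring.defs FactRing_def A_RCOSETS_def')
  have add: "(Q +> x) \<oplus>\<^bsub>?M\<^esub> (Q +> y) = Q +> (x \<oplus> y)"
    and smult: "x \<odot>\<^bsub>?M\<^esub> (Q +> y) = Q +> (x \<otimes> y)"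
    if "x \<in> carrier R" "y \<in> carrier R" for x y
  proof -
    interpret h: ring_hom_ring R "R Quot Q" "(+>) Q" by (rule Q.rcos_ring_hom_ring)
    show "(Q +> x) \<oplus>\<^bsub>?M\<^esub> (Q +> y) = Q +> (x \<oplus> y)" "x \<odot>\<^bsub>?M\<^esub> (Q +> y) = Q +> (x \<otimes> y)"
      using that by (simp_all add: quot_module_def ring.defs)
  qed
  have zero: "\<zero>\<^bsub>?M\<^esub> = Q"
    by (simp add: quot_module_def ring.defs FactRing_def)
  have eq_Q: "Q +> x = Q \<longleftrightarrow> x \<in> Q" if "x \<in> carrier R" for x
    using Q.a_rcos_self [OF that] Q.a_rcos_const [of x] by auto
  have minus: "\<ominus>\<^bsub>?M\<^esub> (Q +> x) = Q +> (\<ominus> x)" if "x \<in> carrier R" for x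
  proof (rule M.minus_equality)
    show "(Q +> (\<ominus> x)) \<oplus>\<^bsub>?M\<^esub> (Q +> x) = \<zero>\<^bsub>?M\<^esub>"
      using that by (simp add: add l_neg zero eq_Q)
  qed (use that carrier in auto)
  define N where "N = (+>) Q ` {x \<in> carrier R. x \<otimes> f \<in> Q}"
  have "submodule N R ?M"
  proof (rule M.submoduleI)
    show "N \<subseteq> carrier ?M" by (auto simp: N_def carrier)
    show "\<zero>\<^bsub>?M\<^esub> \<in> N"
      unfolding N_def zero using f eq_Q [of \<zero>] by (intro image_eqI [of _ _ \<zero>]) simp_all
  next
    fix C assume "C \<in> N"
    then obtain x where x: "C = Q +> x" "x \<in> carrier R" "x \<otimes> f \<in> Q" by (auto simp: N_def)
    show "\<ominus>\<^bsub>?M\<^esub> C \<in> N"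
      unfolding N_def using x f by (intro image_eqI [of _ _ "\<ominus> x"]) (simp_all add: minus l_minus)
    show "C \<oplus>\<^bsub>?M\<^esub> D \<in> N" if "D \<in> N" for D
    proof -
      from that obtain y where y: "D = Q +> y" "y \<in> carrier R" "y \<otimes> f \<in> Q" by (auto simp: N_def)
      show ?thesis
        unfolding N_def using x y f
        by (intro image_eqI [of _ _ "x \<oplus> y"]) (simp_all add: add l_distr)
    qed
    show "a \<odot>\<^bsub>?M\<^esub> C \<in> N" if "a \<in> carrier R" for a
      unfolding N_def using x f that
      by (intro image_eqI [of _ _ "a \<otimes> x"]) (simp_all add: smult m_assoc Q.I_l_closed)
  qed
  moreover have "a \<odot>\<^bsub>?M\<^esub> C \<in> N" if "a \<in> A" "C \<in> carrier ?M" for a C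
  proof -
    from that(2) obtain x where x: "x \<in> carrier R" "C = Q +> x" by (auto simp: carrier)
    have a: "a \<in> carrier R" using that(1) assms(2) by auto
    have "(a \<otimes> x) \<otimes> f = x \<otimes> (a \<otimes> f)" using a x(1) f by (simp add: m_ac)
    then have "(a \<otimes> x) \<otimes> f \<in> Q" using Af [OF that(1)] x(1) by (simp add: Q.I_l_closed)
    then show ?thesis
      unfolding N_def using a x by (intro image_eqI [of _ _ "a \<otimes> x"]) (simp_all add: smult)
  qed
  ultimately have "smult_set R ?M A \<subseteq> N"
    unfolding smult_set_def by blast
  moreover have "Q +> \<one> \<notin> N"
  proof
    assume "Q +> \<one> \<in> N"
    then obtain x where x: "x \<in> carrier R" "x \<otimes> f \<in> Q" "Q +> x = Q +> \<one>"
      by (auto simp: N_def)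
    have "\<one> \<in> Q +> \<one>" by (rule Q.a_rcos_self) simp
    then have "\<one> \<in> Q +> x" by (simp only: x(3))
    then obtain q where q: "q \<in> Q" "\<one> = q \<oplus> x" unfolding a_r_coset_def' by blast
    have "f = (q \<oplus> x) \<otimes> f" using f by (simp flip: q(2))
    also have "\<dots> = q \<otimes> f \<oplus> x \<otimes> f" using f x(1) Q.Icarr [OF q(1)] by (simp add: l_distr)
    also have "\<dots> \<in> Q" using q(1) x(2) f by (simp add: Q.I_r_closed)
    finally show False using f by simp
  qed
  moreover have "Q +> \<one> \<in> carrier ?M"
    unfolding carrier by simp
  ultimately have "smult_set R ?M A \<noteq> carrier ?M"
    by blast
  moreover have "xs = []" if "set xs \<subseteq> A" "regular_seq R ?M xs" for xs
  proof (rule M.regular_seq_of_annihilator_is_empty [OF that(2,1), of "Q +> f"])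
    show "a \<odot>\<^bsub>?M\<^esub> (Q +> f) = \<zero>\<^bsub>?M\<^esub>" if "a \<in> A" for a
    proof -
      have "a \<in> carrier R" using that assms(2) by blast
      then show ?thesis using f Af [OF that] by (simp add: smult zero eq_Q)
    qed
    show "Q +> f \<in> carrier ?M" unfolding carrier using f(1) by (rule imageI)
    show "Q +> f \<noteq> \<zero>\<^bsub>?M\<^esub>" using f by (simp add: zero eq_Q)
  qed
  then have "Sup {enat (length xs) | xs. set xs \<subseteq> A \<and> regular_seq R ?M xs} \<le> 0"
    by (intro Sup_least) (auto simp: zero_enat_def)
  ultimately show ?thesis
    by (simp add: depth_def)
qed


section \<open>Ideals of a polynomial ring\<close>

interpretation mpoly: cring mpoly_ring
  by (rule cring_mpoly_ring)

lemma ideal_mpolyI: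
  fixes A :: "('v, 'k::field) mpoly set"
  assumes "0 \<in> A" and "\<And>p q. p \<in> A \<Longrightarrow> q \<in> A \<Longrightarrow> p + q \<in> A"
    and mult: "\<And>p q. q \<in> A \<Longrightarrow> p * q \<in> A"
  shows "ideal A mpoly_ring"
proof (rule idealI)
  have minus: "\<ominus>\<^bsub>mpoly_ring\<^esub> p = - 1 * p" for p :: "('v, 'k) mpoly"
    by (rule mpoly.minus_equality) auto
  have "- 1 * p \<in> A" if "p \<in> A" for p
    using that by (rule mult)
  then show "subgroup A (add_monoid mpoly_ring)"
    using assms by (intro mpoly.add.subgroupI) (auto simp: minus)
qed (use assms mpoly.ring_axioms in \<open>auto simp: mult.commute\<close>)

lemma
  assumes "ideal A mpoly_ring"
  shows mpoly_ideal_add: "p \<in> A \<Longrightarrow> q \<in> A \<Longrightarrow> p + q \<in> A"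
    and mpoly_ideal_mult: "q \<in> A \<Longrightarrow> p * q \<in> A"
    and mpoly_ideal_zero: "0 \<in> A"
proof -
  interpret ideal A mpoly_ring by fact
  show "p \<in> A \<Longrightarrow> q \<in> A \<Longrightarrow> p + q \<in> A" using a_closed by fastforce
  show "q \<in> A \<Longrightarrow> p * q \<in> A" using I_l_closed [of q p] by simp
  show "0 \<in> A" using zero_closed by simp
qed

lemma mpoly_ideal_sum:
  assumes "ideal A mpoly_ring" and "\<And>i. i \<in> K \<Longrightarrow> p i \<in> A"
  shows "sum p K \<in> A"
  using assms(2)
  by (induction K rule: infinite_finite_induct)
     (auto simp: mpoly_ideal_zero [OF assms(1)] intro: mpoly_ideal_add [OF assms(1)])

lemma ideal_pow_is_ideal:
  assumes "ideal A mpoly_ring"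
  shows "ideal (ideal_pow A n) mpoly_ring"
proof -
  interpret P: comm_monoid "ideals_set mpoly_ring" by (rule mpoly.ideals_set_is_comm_monoid)
  show ?thesis using P.nat_pow_closed [of A n] assms by (simp add: ideals_set_def)
qed

lemma ideal_pow_0: "ideal_pow A 0 = UNIV"
  by (simp add: ideals_set_def)

lemma ideal_pow_Suc: "ideal_pow A (Suc n) = ideal_pow A n \<cdot>\<^bsub>mpoly_ring\<^esub> A"
  by (simp add: ideals_set_def)

lemma mult_in_ideal_pow_Suc: "p \<in> ideal_pow A n \<Longrightarrow> q \<in> A \<Longrightarrow> p * q \<in> ideal_pow A (Suc n)"
  unfolding ideal_pow_Suc using ideal_prod.prod [of p _ q A mpoly_ring] by simp

lemma power_in_ideal_pow: "p \<in> A \<Longrightarrow> p ^ n \<in> ideal_pow A n"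
proof (induction n)
  case 0
  show ?case unfolding ideal_pow_0 by simp
next
  case (Suc n)
  then show ?case using mult_in_ideal_pow_Suc [of "p ^ n" A n p] by (simp only: power_Suc2)
qed

lemma ideal_prod_subset:
  assumes "ideal C mpoly_ring" and "\<And>p q. p \<in> A \<Longrightarrow> q \<in> B \<Longrightarrow> p * q \<in> C"
  shows "A \<cdot>\<^bsub>mpoly_ring\<^esub> B \<subseteq> C"
proof
  fix p assume "p \<in> A \<cdot>\<^bsub>mpoly_ring\<^esub> B"
  then show "p \<in> C"
    by induction (auto simp: assms(2) intro: mpoly_ideal_add [OF assms(1)])
qed

lemma mpoly_var_in_graded_max: "mpoly_var v \<in> graded_max"
  unfolding graded_max_def using mpoly.genideal_self [of "range mpoly_var"] by auto


section \<open>The filtration by weighted order\<close>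

definition weight :: "('v::finite \<Rightarrow> nat) \<Rightarrow> ('v \<Rightarrow>\<^sub>0 nat) \<Rightarrow> nat" where
  "weight w t = (\<Sum>v\<in>UNIV. w v * Poly_Mapping.lookup t v)"

text \<open>
  The order of a polynomial is the least weight of its monomials.  The ideals of order at least \<open>n\<close>
  form a multiplicative filtration, so a bound on the order of \<open>F\<close> yields one for its powers.
\<close>

definition weight_ideal :: "('v::finite \<Rightarrow> nat) \<Rightarrow> nat \<Rightarrow> ('v, 'k::field) mpoly set" where
  "weight_ideal w n = {p. \<forall>t\<in>Poly_Mapping.keys p. n \<le> weight w t}"

lemma weight_0: "weight w 0 = 0"
  by (simp add: weight_def)

lemma weight_add: "weight w (t + t') = weight w t + weight w t'"
  by (simp add: weight_def lookup_add distrib_left sum.distrib)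

lemma weight_single: "weight w (Poly_Mapping.single v n) = w v * n"
  by (simp add: weight_def lookup_single mult_when) (simp add: when_def)

lemma weight_sum: "weight w (sum t K) = (\<Sum>i\<in>K. weight w (t i))"
  by (induction K rule: infinite_finite_induct) (simp_all add: weight_0 weight_add)

lemma weight_const: "weight (\<lambda>v. c) t = c * weight (\<lambda>v. 1) t"
  by (simp add: weight_def sum_distrib_left)

lemma weight_ideal_mult:
  assumes "p \<in> weight_ideal w m" and "q \<in> weight_ideal w n"
  shows "p * q \<in> weight_ideal w (m + n)"
  unfolding weight_ideal_def
proof (clarify)
  fix t assume "t \<in> Poly_Mapping.keys (p * q)"
  then obtain a b where "t = a + b" "a \<in> Poly_Mapping.keys p" "b \<in> Poly_Mapping.keys q"
    using keys_mult by blast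
  then show "m + n \<le> weight w t"
    using assms by (auto simp: weight_ideal_def weight_add add_mono)
qed

lemma weight_ideal_is_ideal:
  "ideal (weight_ideal w n :: ('v::finite, 'k::field) mpoly set) mpoly_ring"
proof (rule ideal_mpolyI)
  fix p q :: "('v, 'k) mpoly"
  show "p + q \<in> weight_ideal w n" if "p \<in> weight_ideal w n" "q \<in> weight_ideal w n"
    using that keys_add [of p q] unfolding weight_ideal_def by blast
  have "p \<in> weight_ideal w 0"
    by (simp add: weight_ideal_def)
  then show "p * q \<in> weight_ideal w n" if "q \<in> weight_ideal w n"
    using weight_ideal_mult [of p w 0 q n] that by simp
qed (simp add: weight_ideal_def)

lemma ideal_pow_subset_weight_ideal:
  assumes "A \<subseteq> weight_ideal w d"
  shows "ideal_pow A n \<subseteq> weight_ideal w (n * d)"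
proof (induction n)
  case 0
  show ?case by (simp add: weight_ideal_def)
next
  case (Suc n)
  show ?case
    unfolding ideal_pow_Suc
  proof (rule ideal_prod_subset [OF weight_ideal_is_ideal])
    fix p q assume "p \<in> ideal_pow A n" "q \<in> A"
    with Suc assms show "p * q \<in> weight_ideal w (Suc n * d)"
      using weight_ideal_mult [of p w "n * d" q d] by (auto simp: add.commute)
  qed
qed

lemma mpoly_eq_sum_terms:
  "p = (\<Sum>t\<in>Poly_Mapping.keys p. Poly_Mapping.single t (Poly_Mapping.lookup p t))"
proof (rule poly_mapping_eqI)
  fix k
  have "Poly_Mapping.lookup
      (\<Sum>t\<in>Poly_Mapping.keys p. Poly_Mapping.single t (Poly_Mapping.lookup p t)) k =
      (\<Sum>t\<in>Poly_Mapping.keys p. if t = k then Poly_Mapping.lookup p t else 0)"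
    by (simp only: lookup_sum lookup_single when_def)
  also have "\<dots> = Poly_Mapping.lookup p k"
    by (simp only: sum.delta' sum.delta finite_keys) (simp add: in_keys_iff)
  finally show "Poly_Mapping.lookup p k = Poly_Mapping.lookup
      (\<Sum>t\<in>Poly_Mapping.keys p. Poly_Mapping.single t (Poly_Mapping.lookup p t)) k"
    by (rule sym)
qed

lemma lookup_single_one_mult:
  fixes p :: "('v, 'k::field) mpoly"
  shows "Poly_Mapping.lookup (Poly_Mapping.single a 1 * p) (a + t) = Poly_Mapping.lookup p t"
proof -
  let ?T = "\<Sum>b\<in>Poly_Mapping.keys p. Poly_Mapping.single b (Poly_Mapping.lookup p b)"
  let ?T' = "\<Sum>b\<in>Poly_Mapping.keys p. Poly_Mapping.single (a + b) (Poly_Mapping.lookup p b)"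
  have "Poly_Mapping.single a 1 * ?T = ?T'"
    by (simp only: sum_distrib_left mult_single mult_1_left)
  also have "?T = p"
    by (rule mpoly_eq_sum_terms [symmetric])
  finally have "Poly_Mapping.lookup (Poly_Mapping.single a 1 * p) (a + t) =
      Poly_Mapping.lookup ?T' (a + t)"
    by (rule arg_cong)
  also have "\<dots> = (\<Sum>b\<in>Poly_Mapping.keys p. if b = t then Poly_Mapping.lookup p b else 0)"
    by (simp only: lookup_sum lookup_single when_def add_left_cancel)
  also have "\<dots> = Poly_Mapping.lookup p t"
    by (simp only: sum.delta' sum.delta finite_keys) (simp add: in_keys_iff)
  finally show ?thesis .
qed

text \<open>
  Multiplication by a variable shifts the exponent vectors without any cancellation, so it raises the
  order by exactly the weight of the variable.  This keeps the socle element out of the power.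
\<close>

lemma mult_mpoly_var_not_in_weight_ideal:
  fixes p :: "('v::finite, 'k::field) mpoly"
  assumes "p \<notin> weight_ideal w n"
  shows "p * mpoly_var v \<notin> weight_ideal w (n + w v)"
proof -
  from assms obtain t where t: "t \<in> Poly_Mapping.keys p" "weight w t < n"
    by (auto simp: weight_ideal_def not_le)
  let ?e = "Poly_Mapping.single v 1 :: 'v \<Rightarrow>\<^sub>0 nat"
  have "?e + t \<in> Poly_Mapping.keys (p * mpoly_var v)"
    using t(1) lookup_single_one_mult [of ?e p t]
    by (simp add: mpoly_var_def mult.commute in_keys_iff)
  moreover have "weight w (?e + t) < n + w v"
    using t(2) by (simp add: weight_add weight_single)
  ultimately show ?thesis
    by (auto simp: weight_ideal_def not_le)
qed

lemma mult_mpoly_var_power_not_in_weight_ideal: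
  assumes "p \<notin> weight_ideal w n"
  shows "p * mpoly_var v ^ k \<notin> weight_ideal w (n + k * w v)"
proof (induction k)
  case 0
  show ?case using assms by simp
next
  case (Suc k)
  from mult_mpoly_var_not_in_weight_ideal [OF this, of v] show ?case
    by (simp add: mult_ac add_ac)
qed

lemma graded_max_subset_weight_ideal:
  assumes "\<And>v. c \<le> w v"
  shows "graded_max \<subseteq> weight_ideal w c"
  unfolding graded_max_def
  by (rule mpoly.genideal_minimal [OF weight_ideal_is_ideal])
     (auto simp: weight_ideal_def mpoly_var_def weight_single assms)


section \<open>Renaming of variables\<close>

lemma push_forward_single:
  "push_forward f (Poly_Mapping.single a c) = Poly_Mapping.single (f a) c"
  by (cases "c = 0") (simp_all add: push_forward_def)

lemma mpoly_rename_var: "mpoly_rename f (mpoly_var v) = mpoly_var (f v)"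
  by (simp add: mpoly_rename_def mpoly_var_def push_forward_single)

lemma lookup_push_forward:
  assumes "inj f"
  shows "Poly_Mapping.lookup (push_forward f p) (f a) = Poly_Mapping.lookup p a"
proof -
  have "Poly_Mapping.lookup (push_forward f p) (f a) =
      (\<Sum>t\<in>Poly_Mapping.keys p. if t = a then Poly_Mapping.lookup p t else 0)"
    by (simp only: push_forward_def lookup_sum lookup_single when_def inj_eq [OF assms])
  also have "\<dots> = Poly_Mapping.lookup p a"
    by (simp only: sum.delta' sum.delta finite_keys) (simp add: in_keys_iff)
  finally show ?thesis .
qed

lemma inj_push_forward:
  assumes "inj f"
  shows "inj (push_forward f)"
proof (rule injI)
  fix p q :: "'a \<Rightarrow>\<^sub>0 'c" assume "push_forward f p = push_forward f q"
  then show "p = q"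
    using lookup_push_forward [OF assms] by (metis poly_mapping_eqI)
qed

lemma keys_push_forward:
  assumes "inj f"
  shows "Poly_Mapping.keys (push_forward f p) = f ` Poly_Mapping.keys p"
proof
  show "f ` Poly_Mapping.keys p \<subseteq> Poly_Mapping.keys (push_forward f p)"
    by (auto simp: in_keys_iff lookup_push_forward [OF assms])
  show "Poly_Mapping.keys (push_forward f p) \<subseteq> f ` Poly_Mapping.keys p"
  proof
    fix b assume b: "b \<in> Poly_Mapping.keys (push_forward f p)"
    show "b \<in> f ` Poly_Mapping.keys p"
    proof (rule ccontr)
      assume "b \<notin> f ` Poly_Mapping.keys p"
      then have "Poly_Mapping.lookup (push_forward f p) b = 0"
        unfolding push_forward_def lookup_sum
        by (intro sum.neutral) (auto simp: lookup_single when_def)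
      with b show False by (simp add: in_keys_iff)
    qed
  qed
qed

lemma weight_push_forward: "weight w (push_forward f t) = weight (w \<circ> f) t"
proof -
  have "weight w (push_forward f t) =
      (\<Sum>v\<in>Poly_Mapping.keys t. w (f v) * Poly_Mapping.lookup t v)"
    by (simp add: push_forward_def weight_sum weight_single)
  also have "\<dots> = weight (w \<circ> f) t"
    unfolding weight_def by (intro sum.mono_neutral_cong_left) (auto simp: in_keys_iff)
  finally show ?thesis .
qed

text \<open>
  Orders in the tensor product are computed in the factors: an injective renaming merges no
  monomials, and it pulls the weights back.
\<close>

lemma mpoly_rename_in_weight_ideal_iff:
  assumes "inj f"
  shows "mpoly_rename f p \<in> weight_ideal w n \<longleftrightarrow> p \<in> weight_ideal (w \<circ> f) n"
  by (simp add: weight_ideal_def mpoly_rename_def keys_push_forward inj_push_forward assms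
      weight_push_forward)


section \<open>The socle element\<close>

text \<open>
  The weight \<open>\<lambda>v. of_bool (v \<in> U)\<close> is the degree in the variables from \<open>U\<close>.
\<close>

lemma mpoly_single_eq_var_mult:
  fixes c :: "'k::field"
  assumes "weight (\<lambda>v. of_bool (v \<in> U)) t \<ge> Suc n"
  obtains u t' where "u \<in> U" and "weight (\<lambda>v. of_bool (v \<in> U)) t' \<ge> n"
    and "Poly_Mapping.single t c = mpoly_var u * Poly_Mapping.single t' c"
proof -
  have "\<exists>u. of_bool (u \<in> U) * Poly_Mapping.lookup t u \<noteq> (0::nat)"
  proof (rule ccontr)
    assume "\<not> ?thesis"
    then have "weight (\<lambda>v. of_bool (v \<in> U)) t = 0" by (simp add: weight_def)
    with assms show False by simp
  qed
  then obtain u where u: "u \<in> U" "Poly_Mapping.lookup t u \<noteq> 0" by auto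
  let ?e = "Poly_Mapping.single u 1 :: 'a \<Rightarrow>\<^sub>0 nat"
  have t: "t = ?e + (t - ?e)"
    using u(2) by (intro poly_mapping_eqI) (auto simp: lookup_add lookup_minus lookup_single when_def)
  show thesis
  proof
    show "u \<in> U" by (fact u(1))
    have "weight (\<lambda>v. of_bool (v \<in> U)) t = 1 + weight (\<lambda>v. of_bool (v \<in> U)) (t - ?e)"
      by (subst t) (simp add: weight_add weight_single u(1))
    then show "weight (\<lambda>v. of_bool (v \<in> U)) (t - ?e) \<ge> n"
      using assms by simp
    show "Poly_Mapping.single t c = mpoly_var u * Poly_Mapping.single (t - ?e) c"
      by (subst t) (simp add: mpoly_var_def mult_single)
  qed
qed

text \<open>
  Every monomial of \<open>g\<close> contains two factors \<open>u\<close>, \<open>u'\<close> from \<open>U\<close>, and \<open>u u' y v = (u y) (u' v)\<close>.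
\<close>

lemma mult_two_vars_in_square:
  assumes F: "ideal F mpoly_ring"
    and cross: "\<And>u v. u \<in> U \<Longrightarrow> v \<notin> U \<Longrightarrow> mpoly_var u * mpoly_var v \<in> F"
    and g: "g \<in> weight_ideal (\<lambda>v. of_bool (v \<in> U)) 2"
    and "y \<notin> U" and "v \<notin> U"
  shows "g * mpoly_var y * mpoly_var v \<in> ideal_pow F 2"
proof -
  have "Poly_Mapping.single t (Poly_Mapping.lookup g t) * mpoly_var y * mpoly_var v \<in> ideal_pow F 2"
    if "t \<in> Poly_Mapping.keys g" for t
  proof -
    let ?c = "Poly_Mapping.lookup g t"
    have "weight (\<lambda>v. of_bool (v \<in> U)) t \<ge> Suc (Suc 0)"
      using g that by (auto simp: weight_ideal_def numeral_2_eq_2)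
    then obtain u t1 where u: "u \<in> U" "weight (\<lambda>v. of_bool (v \<in> U)) t1 \<ge> Suc 0"
      and t: "Poly_Mapping.single t ?c = mpoly_var u * Poly_Mapping.single t1 ?c"
      by (rule mpoly_single_eq_var_mult)
    from u(2) obtain u' t2 where u': "u' \<in> U"
      and t1: "Poly_Mapping.single t1 ?c = mpoly_var u' * Poly_Mapping.single t2 ?c"
      by (rule mpoly_single_eq_var_mult)
    let ?p = "mpoly_var u * mpoly_var y" and ?q = "mpoly_var u' * mpoly_var v"
    have "1 \<in> ideal_pow F 0" unfolding ideal_pow_0 by simp
    then have "1 * ?p * ?q \<in> ideal_pow F (Suc (Suc 0))"
      using cross u(1) u' assms(4,5) by (intro mult_in_ideal_pow_Suc)
    then have "Poly_Mapping.single t2 ?c * (?p * ?q) \<in> ideal_pow F 2"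
      using mpoly_ideal_mult [OF ideal_pow_is_ideal [OF F]]
      unfolding numeral_2_eq_2 mult_1_left by blast
    moreover have "Poly_Mapping.single t ?c * mpoly_var y * mpoly_var v =
        Poly_Mapping.single t2 ?c * (?p * ?q)"
      unfolding t t1 by (simp only: mult_ac)
    ultimately show ?thesis by simp
  qed
  then have "(\<Sum>t\<in>Poly_Mapping.keys g.
      Poly_Mapping.single t (Poly_Mapping.lookup g t) * mpoly_var y * mpoly_var v) \<in> ideal_pow F 2"
    by (intro mpoly_ideal_sum ideal_pow_is_ideal F)
  then show ?thesis
    by (subst mpoly_eq_sum_terms [of g]) (simp add: sum_distrib_right)
qed

text \<open>
  The element \<open>f = g x\<^sup>k y\<^bsup>k+1\<^esup>\<close> is multiplied into \<open>F\<^bsup>k+2\<^esup>\<close> by every variable \<open>z\<close>.  For \<open>z\<close> in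
  \<open>U\<close>, use \<open>z f = (x y)\<^sup>k (z y) g\<close>, a product of \<open>k + 2\<close> elements of \<open>F\<close>; for the other variables
  use \<open>z f = (x y)\<^sup>k (g y z)\<close>, where the last factor lies in \<open>F\<^sup>2\<close>.
\<close>

lemma graded_max_mult_socle:
  fixes F :: "('v, 'k::field) mpoly set"
  assumes F: "ideal F mpoly_ring"
    and cross: "\<And>u v. u \<in> U \<Longrightarrow> v \<notin> U \<Longrightarrow> mpoly_var u * mpoly_var v \<in> F"
    and "g \<in> F" and square: "\<And>v. v \<notin> U \<Longrightarrow> g * mpoly_var y * mpoly_var v \<in> ideal_pow F 2"
    and "x \<in> U" and "y \<notin> U" and "a \<in> graded_max"
  shows "a * (g * mpoly_var x ^ k * mpoly_var y ^ Suc k) \<in> ideal_pow F (Suc (Suc k))"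
proof -
  let ?f = "g * mpoly_var x ^ k * mpoly_var y ^ Suc k"
  note pow = ideal_pow_is_ideal [OF F]
  have xy: "(mpoly_var x * mpoly_var y) ^ k \<in> ideal_pow F k"
    using assms by (intro power_in_ideal_pow cross)
  have var: "mpoly_var z * ?f \<in> ideal_pow F (Suc (Suc k))" for z
  proof (cases "z \<in> U")
    case True
    then have "(mpoly_var x * mpoly_var y) ^ k * (mpoly_var z * mpoly_var y) * g
        \<in> ideal_pow F (Suc (Suc k))"
      using xy cross assms(3,6) by (intro mult_in_ideal_pow_Suc)
    then show ?thesis
      by (simp add: power_mult_distrib mult_ac)
  next
    case False
    interpret P: comm_monoid "ideals_set mpoly_ring" by (rule mpoly.ideals_set_is_comm_monoid)
    have "(mpoly_var x * mpoly_var y) ^ k * (g * mpoly_var y * mpoly_var z)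
        \<in> ideal_pow F k \<cdot>\<^bsub>mpoly_ring\<^esub> ideal_pow F 2"
      using ideal_prod.prod [OF xy square [OF False], of mpoly_ring] by simp
    also have "ideal_pow F k \<cdot>\<^bsub>mpoly_ring\<^esub> ideal_pow F 2 = ideal_pow F (k + 2)"
      using P.nat_pow_mult [of F k 2] F by (simp add: ideals_set_def)
    finally show ?thesis
      by (simp add: power_mult_distrib mult_ac)
  qed
  have "ideal {p. p * ?f \<in> ideal_pow F (Suc (Suc k))} mpoly_ring"
    using mpoly_ideal_zero [OF pow] mpoly_ideal_add [OF pow] mpoly_ideal_mult [OF pow]
    by (intro ideal_mpolyI) (simp_all add: distrib_right mult.assoc del: power_Suc nat_pow_Suc)
  then have "graded_max \<subseteq> {p. p * ?f \<in> ideal_pow F (Suc (Suc k))}"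
    unfolding graded_max_def using var by (intro mpoly.genideal_minimal) auto
  with assms(7) show ?thesis by blast
qed


section \<open>Powers of fiber products\<close>

text \<open>
  Stated for arbitrary complementary embeddings \<open>\<iota>\<close>, \<open>\<kappa>\<close> of the two sets of variables, so that it
  applies with either factor in the first place; the first ideal is the nonzero one.
\<close>

lemma depth_fiber_product_pow:
  fixes I :: "('a::finite, 'k::field) mpoly set" and J :: "('b::finite, 'k) mpoly set"
    and \<iota> :: "'a \<Rightarrow> 'v::finite" and \<kappa> :: "'b \<Rightarrow> 'v"
  assumes inj: "inj \<iota>" "inj \<kappa>" and range: "range \<kappa> = - range \<iota>"
    and I: "I \<subseteq> ideal_pow graded_max 2" "I \<noteq> {0}" "ideal I mpoly_ring"
    and J: "J \<subseteq> ideal_pow graded_max 2"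
    and F: "F = Idl\<^bsub>mpoly_ring\<^esub> (mpoly_rename \<iota> ` I) <+>\<^bsub>mpoly_ring\<^esub> Idl\<^bsub>mpoly_ring\<^esub> (mpoly_rename \<kappa> ` J)
        <+>\<^bsub>mpoly_ring\<^esub> ((Idl\<^bsub>mpoly_ring\<^esub> (mpoly_rename \<iota> ` graded_max)) \<cdot>\<^bsub>mpoly_ring\<^esub>
            (Idl\<^bsub>mpoly_ring\<^esub> (mpoly_rename \<kappa> ` graded_max)))"
    and s: "s \<ge> 2"
  shows "depth mpoly_ring graded_max (quot_module mpoly_ring (ideal_pow F s)) = 0"
proof -
  let ?U = "range \<iota>"
  let ?P = "Idl\<^bsub>mpoly_ring\<^esub> (mpoly_rename \<iota> ` I)" and ?Q = "Idl\<^bsub>mpoly_ring\<^esub> (mpoly_rename \<kappa> ` J)"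
  let ?m = "Idl\<^bsub>mpoly_ring\<^esub> (mpoly_rename \<iota> ` graded_max) :: ('v, 'k) mpoly set"
  let ?n = "Idl\<^bsub>mpoly_ring\<^esub> (mpoly_rename \<kappa> ` graded_max) :: ('v, 'k) mpoly set"
  note Idl = mpoly.genideal_ideal [of "mpoly_rename _ ` _", simplified]
  have mn: "ideal (?m \<cdot>\<^bsub>mpoly_ring\<^esub> ?n) mpoly_ring"
    by (intro mpoly.ideal_prod_is_ideal Idl)
  have idF: "ideal F mpoly_ring"
    unfolding F by (intro mpoly.add_ideals mn Idl)
  have P_F: "?P \<subseteq> F" and mn_F: "?m \<cdot>\<^bsub>mpoly_ring\<^esub> ?n \<subseteq> F"
  proof -
    have "0 \<in> ?Q" "0 \<in> ?P" "0 \<in> ?m \<cdot>\<^bsub>mpoly_ring\<^esub> ?n"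
      by (intro mpoly_ideal_zero mn Idl)+
    then show "?P \<subseteq> F" "?m \<cdot>\<^bsub>mpoly_ring\<^esub> ?n \<subseteq> F"
      unfolding F set_add_def' by force+
  qed
  have square: "ideal_pow graded_max 2 \<subseteq> weight_ideal (\<lambda>v. 1) 2"
    using ideal_pow_subset_weight_ideal [OF graded_max_subset_weight_ideal [of 1 "\<lambda>v. 1"], of 2]
    by simp

  \<comment> \<open>The socle element is built from an element \<open>p\<close> of least order \<open>d\<close> in \<open>I\<close>.\<close>
  define d where "d = (LEAST n. \<exists>p\<in>I. \<exists>t\<in>Poly_Mapping.keys p. weight (\<lambda>v. 1) t = n)"
  have "\<exists>p\<in>I. p \<noteq> 0" using I(2) mpoly_ideal_zero [OF I(3)] by blast
  then have "\<exists>n. \<exists>p\<in>I. \<exists>t\<in>Poly_Mapping.keys p. weight (\<lambda>v. 1) t = n"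
    using keys_eq_empty by (metis all_not_in_conv)
  then have "\<exists>p\<in>I. \<exists>t\<in>Poly_Mapping.keys p. weight (\<lambda>v. 1) t = d"
    unfolding d_def by (rule LeastI_ex)
  then obtain p t where p: "p \<in> I" "t \<in> Poly_Mapping.keys p" "weight (\<lambda>v. 1) t = d" by blast
  have d_le: "I \<subseteq> weight_ideal (\<lambda>v. 1) d"
    unfolding weight_ideal_def d_def by (auto intro: Least_le)
  have "d \<ge> 2"
    using I(1) square p by (auto simp: weight_ideal_def)
  define g where "g = mpoly_rename \<iota> p"
  \<comment> \<open>With these weights the generators of \<open>F\<close> from \<open>I\<close> and from the mixed products both have
    order \<open>d\<close>, and those from \<open>J\<close> have order at least \<open>2 (d - 1) \<ge> d\<close>.\<close>
  define w where "w v = (if v \<in> ?U then 1 else d - 1)" for v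
  have w_iota: "w \<circ> \<iota> = (\<lambda>v. 1)" and w_kappa: "w \<circ> \<kappa> = (\<lambda>v. d - 1)"
    using range by (auto simp: w_def fun_eq_iff)

  have "?P \<subseteq> weight_ideal w d"
    using d_le by (intro mpoly.genideal_minimal weight_ideal_is_ideal)
      (auto simp: mpoly_rename_in_weight_ideal_iff inj w_iota)
  moreover have "?Q \<subseteq> weight_ideal w d"
  proof -
    have "d \<le> weight (\<lambda>v. d - 1) t" if "2 \<le> weight (\<lambda>v. 1) t" for t :: "'b \<Rightarrow>\<^sub>0 nat"
    proof -
      have "d \<le> (d - 1) * 2" using \<open>d \<ge> 2\<close> by simp
      also have "\<dots> \<le> (d - 1) * weight (\<lambda>v. 1) t" using that by simp
      finally show ?thesis by (subst weight_const)
    qed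
    then have "J \<subseteq> weight_ideal (\<lambda>v. d - 1) d"
      using J square unfolding weight_ideal_def by blast
    then show ?thesis
      by (intro mpoly.genideal_minimal weight_ideal_is_ideal)
        (auto simp: mpoly_rename_in_weight_ideal_iff inj w_kappa)
  qed
  moreover have "?m \<cdot>\<^bsub>mpoly_ring\<^esub> ?n \<subseteq> weight_ideal w d"
  proof (rule ideal_prod_subset [OF weight_ideal_is_ideal])
    fix p q assume pq: "p \<in> ?m" "q \<in> ?n"
    have "?m \<subseteq> weight_ideal w 1"
      using graded_max_subset_weight_ideal [of 1 "\<lambda>v. 1"]
      by (intro mpoly.genideal_minimal weight_ideal_is_ideal)
        (auto simp: mpoly_rename_in_weight_ideal_iff inj w_iota)
    moreover have "?n \<subseteq> weight_ideal w (d - 1)"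
      using graded_max_subset_weight_ideal [of "d - 1" "\<lambda>v. d - 1"]
      by (intro mpoly.genideal_minimal weight_ideal_is_ideal)
        (auto simp: mpoly_rename_in_weight_ideal_iff inj w_kappa)
    ultimately have "p * q \<in> weight_ideal w (1 + (d - 1))"
      using pq weight_ideal_mult by blast
    then show "p * q \<in> weight_ideal w d" using \<open>d \<ge> 2\<close> by simp
  qed
  ultimately have F_weight: "F \<subseteq> weight_ideal w d"
    unfolding F set_add_def'
    by (auto intro!: mpoly_ideal_add [OF weight_ideal_is_ideal])

  have cross: "mpoly_var u * mpoly_var v \<in> F" if "u \<in> ?U" "v \<notin> ?U" for u v
  proof -
    from that(1) obtain i where i: "u = \<iota> i" by blast
    from that(2) obtain j where j: "v = \<kappa> j" using range by blast
    have "mpoly_var u \<in> ?m" "mpoly_var v \<in> ?n"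
      using mpoly.genideal_self [of "mpoly_rename \<iota> ` graded_max"]
        mpoly.genideal_self [of "mpoly_rename \<kappa> ` graded_max"]
        mpoly_var_in_graded_max [of i] mpoly_var_in_graded_max [of j]
      by (auto simp: i j simp flip: mpoly_rename_var)
    then show ?thesis
      using mn_F ideal_prod.prod [of "mpoly_var u" ?m "mpoly_var v" ?n mpoly_ring] by auto
  qed
  have "g \<in> F"
    using P_F p(1) mpoly.genideal_self [of "mpoly_rename \<iota> ` I"] by (auto simp: g_def)
  have "(\<lambda>v. of_bool (v \<in> ?U)) \<circ> \<iota> = (\<lambda>v. 1 :: nat)"
    by auto
  then have g_order: "g \<in> weight_ideal (\<lambda>v. of_bool (v \<in> ?U)) 2"
    using p(1) I(1) square unfolding g_def by (auto simp: mpoly_rename_in_weight_ideal_iff inj)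
  have g_not: "g \<notin> weight_ideal w (Suc d)"
    using p(2,3) unfolding g_def mpoly_rename_in_weight_ideal_iff [OF inj(1)] w_iota
    by (auto simp: weight_ideal_def not_less_eq_eq intro!: bexI [of _ t])

  obtain k where k: "s = Suc (Suc k)"
    using s by (metis add_2_eq_Suc le_Suc_ex)
  obtain e where e: "d = Suc e"
    using \<open>d \<ge> 2\<close> by (cases d) auto
  define x y where "x = \<iota> undefined" and "y = \<kappa> undefined"
  have x: "x \<in> ?U" and y: "y \<notin> ?U"
    using range by (auto simp: x_def y_def)
  define f where "f = g * mpoly_var x ^ k * mpoly_var y ^ Suc k"
  have "a * f \<in> ideal_pow F s" if "a \<in> graded_max" for a
    unfolding f_def k
    by (rule graded_max_mult_socle [OF idF cross \<open>g \<in> F\<close> _ x y that])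
       (auto intro: mult_two_vars_in_square [OF idF cross g_order y])
  moreover have "f \<notin> ideal_pow F s"
  proof -
    have "f \<notin> weight_ideal w (Suc d + k * w x + Suc k * w y)"
      unfolding f_def by (intro mult_mpoly_var_power_not_in_weight_ideal g_not)
    \<comment> \<open>\<open>(d + 1) + (s - 2) + (s - 1) (d - 1) = s d\<close>\<close>
    also have "Suc d + k * w x + Suc k * w y = s * d"
      using x y by (simp add: w_def k e)
    finally show ?thesis
      using ideal_pow_subset_weight_ideal [OF F_weight, of s] by blast
  qed
  ultimately show ?thesis
    by (intro mpoly.depth_quot_eq_0 [where f = f] ideal_pow_is_ideal idF) simp_all
qed

theorem theorem1p2:
  fixes I :: "('a::finite, 'k::field) mpoly set"
    and J :: "('b::finite, 'k) mpoly set"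
    and s :: nat
  assumes "ideal I mpoly_ring" and "homogeneous_ideal I" and "I \<subseteq> ideal_pow graded_max 2"
    and "ideal J mpoly_ring" and "homogeneous_ideal J" and "J \<subseteq> ideal_pow graded_max 2"
    and "CHAR('k) = 0 \<or> (monomial_ideal I \<and> monomial_ideal J)"
    and "I \<noteq> {0} \<or> J \<noteq> {0}"
    and "s \<ge> 2"
  shows "depth mpoly_ring graded_max
           (quot_module mpoly_ring (ideal_pow (fiber_product I J) s)) = 0"
proof -
  have range: "range (Inr :: 'b \<Rightarrow> 'a + 'b) = - range Inl"
    using UNIV_sum by blast
  show ?thesis
  proof (cases "I = {0}")
    case False
    show ?thesis
      by (rule depth_fiber_product_pow [of Inl Inr I J])
         (use assms False range in \<open>simp_all add: fiber_product_def extend_left_def extend_right_def\<close>)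
  next
    case True
    have "fiber_product I J =
        extend_right J <+>\<^bsub>mpoly_ring\<^esub> extend_left I
          <+>\<^bsub>mpoly_ring\<^esub> (extend_right graded_max \<cdot>\<^bsub>mpoly_ring\<^esub> extend_left graded_max)"
      unfolding fiber_product_def
      using mpoly.set_add_comm [of "extend_left I" "extend_right J"]
        mpoly.ideal_prod_commute
          [of "extend_left (graded_max :: ('a, 'k) mpoly set)"
              "extend_right (graded_max :: ('b, 'k) mpoly set)"]
      by (simp add: extend_left_def extend_right_def mpoly.genideal_ideal)
    then show ?thesis
      by (intro depth_fiber_product_pow [of Inr Inl J I])
         (use assms True range in \<open>auto simp: extend_left_def extend_right_def\<close>)
  qed
qed

end
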